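(* For a finite simple digraph $\mathcal{G}=(\mathcal{N},\mathcal{A})$ (an instance of BP-FASP), let $\mathcal{P}^1$ and $\mathcal{P}^2$ denote the feasible regions of the linear programming relaxations of BLP #1 and BLP #2 for $\mathcal{G}$, respectively. Then for every instance $\mathcal{P}^1\subseteq\mathcal{P}^2$, and this inclusion can be strict, i.e. there exists an instance for which $\mathcal{P}^1\subsetneq\mathcal{P}^2$.
   Context: A simple digraph has no self-loops and no multiple arcs, but may contain both $(i,j)$ and $(j,i)$. An instance of BP-FASP (the bidirectionality-preserving feedback arc set problem) is a finite simple digraph $\mathcal{G}=(\mathcal{N},\mathcal{A})$ with arc weights $w_{ij}\ge 0$; put $n=|\mathcal{N}|$. Both formulations use binary variables $y_{ij}\in\{0,1\}$ for $i\ne j\in\mathcal{N}$ and minimize $\sum_{(i,j)\in\mathcal{A}}w_{ij}(1-y_{ij})$. BLP #1 has the constraints: (1b) $y_{ij}+y_{ji}\ge 1$ for all distinct $i,j\in\mathcal{N}$ with $(i,j)\in\mathcal{A}$ and $(j,i)\in\mathcal{A}$; (1c) $y_{ij}+y_{ji}=1$ for all distinct $i,j\in\mathcal{N}$ with $(i,j)\notin\mathcal{A}$ or $(j,i)\notin\mathcal{A}$; (1d) $y_{ij}-y_{ik}-y_{kj}\ge -1$ for all pairwise distinct $i,j,k\in\mathcal{N}$. BLP #2 has the constraints (1b), (1c), and, for all distinct $i,j\in\mathcal{N}$: (2a) $\sum_{u\in\mathcal{N}\setminus\{i,j\}}(y_{uj}-y_{ui})\ge (n-2)(y_{ij}-1)$;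 (2b) $\sum_{u\in\mathcal{N}\setminus\{i,j\}}(y_{iu}-y_{ju})\ge (n-2)(y_{ij}-1)$; (2c) $\sum_{u\in\mathcal{N}\setminus\{i,j\}}(y_{iu}+y_{uj})\le (n-2)(y_{ij}+1)$. The LP relaxation of each program replaces $y_{ij}\in\{0,1\}$ by $0\le y_{ij}\le 1$; its feasible region is a subset of $\mathbb{R}^{n(n-1)}$. *)

theory Defs
  imports "HOL-Analysis.Analysis" "Graph_Theory.Pair_Digraph"
begin

text \<open>
  The locale \<open>pair_digraph\<close> describes finite digraphs without loops whose arcs are
  pairs of vertices, so there are no parallel arcs either.
\<close>

locale bp_fasp = pair_digraph G for G :: "'a pair_pre_digraph" +
  fixes w :: "'a \<times> 'a \<Rightarrow> real"
  assumes weight_nonneg: "a \<in> parcs G \<Longrightarrow> 0 \<le> w a"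

definition var_index :: "'a pair_pre_digraph \<Rightarrow> ('a \<times> 'a) set" where
  "var_index G = {(i, j). i \<in> pverts G \<and> j \<in> pverts G \<and> i \<noteq> j}"

definition objective :: "'a pair_pre_digraph \<Rightarrow> ('a \<times> 'a \<Rightarrow> real) \<Rightarrow> ('a \<times> 'a \<Rightarrow> real) \<Rightarrow> real" where
  "objective G w y = (\<Sum>a\<in>parcs G. w a * (1 - y a))"

definition bidirectional_constr :: "'a pair_pre_digraph \<Rightarrow> ('a \<times> 'a \<Rightarrow> real) \<Rightarrow> bool" where
  "bidirectional_constr G y \<longleftrightarrow>
     (\<forall>i\<in>pverts G. \<forall>j\<in>pverts G. i \<noteq> j \<longrightarrow> (i, j) \<in> parcs G \<and> (j, i) \<in> parcs G \<longrightarrow>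
        y (i, j) + y (j, i) \<ge> 1)"

definition non_bidirectional_constr :: "'a pair_pre_digraph \<Rightarrow> ('a \<times> 'a \<Rightarrow> real) \<Rightarrow> bool" where
  "non_bidirectional_constr G y \<longleftrightarrow>
     (\<forall>i\<in>pverts G. \<forall>j\<in>pverts G. i \<noteq> j \<longrightarrow> (i, j) \<notin> parcs G \<or> (j, i) \<notin> parcs G \<longrightarrow>
        y (i, j) + y (j, i) = 1)"

definition triangle_constr :: "'a pair_pre_digraph \<Rightarrow> ('a \<times> 'a \<Rightarrow> real) \<Rightarrow> bool" where
  "triangle_constr G y \<longleftrightarrow>
     (\<forall>i\<in>pverts G. \<forall>j\<in>pverts G. \<forall>k\<in>pverts G. i \<noteq> j \<longrightarrow> i \<noteq> k \<longrightarrow> j \<noteq> k \<longrightarrow>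
        y (i, j) - y (i, k) - y (k, j) \<ge> - 1)"

definition in_sum_constr :: "'a pair_pre_digraph \<Rightarrow> ('a \<times> 'a \<Rightarrow> real) \<Rightarrow> bool" where
  "in_sum_constr G y \<longleftrightarrow>
     (\<forall>i\<in>pverts G. \<forall>j\<in>pverts G. i \<noteq> j \<longrightarrow>
        (\<Sum>u\<in>pverts G - {i, j}. y (u, j) - y (u, i))
          \<ge> (real (card (pverts G)) - 2) * (y (i, j) - 1))"

definition out_sum_constr :: "'a pair_pre_digraph \<Rightarrow> ('a \<times> 'a \<Rightarrow> real) \<Rightarrow> bool" where
  "out_sum_constr G y \<longleftrightarrow>
     (\<forall>i\<in>pverts G. \<forall>j\<in>pverts G. i \<noteq> j \<longrightarrow>
        (\<Sum>u\<in>pverts G - {i, j}. y (i, u) - y (j, u))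
          \<ge> (real (card (pverts G)) - 2) * (y (i, j) - 1))"

definition through_sum_constr :: "'a pair_pre_digraph \<Rightarrow> ('a \<times> 'a \<Rightarrow> real) \<Rightarrow> bool" where
  "through_sum_constr G y \<longleftrightarrow>
     (\<forall>i\<in>pverts G. \<forall>j\<in>pverts G. i \<noteq> j \<longrightarrow>
        (\<Sum>u\<in>pverts G - {i, j}. y (i, u) + y (u, j))
          \<le> (real (card (pverts G)) - 2) * (y (i, j) + 1))"

text \<open>
  The feasible regions are parametrised by the domain \<open>B\<close> of the variables: \<open>{0, 1}\<close> gives
  the binary program, the interval \<open>{0..1}\<close> its LP relaxation.  A point of the
  \<open>n * (n - 1)\<close>-dimensional space is an extensional function on \<open>var_index G\<close>, so that
  distinct functions in a region are distinct points.
\<close>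

definition blp1_region :: "real set \<Rightarrow> 'a pair_pre_digraph \<Rightarrow> ('a \<times> 'a \<Rightarrow> real) set" where
  "blp1_region B G = {y \<in> var_index G \<rightarrow>\<^sub>E B.
     bidirectional_constr G y \<and> non_bidirectional_constr G y \<and> triangle_constr G y}"

definition blp2_region :: "real set \<Rightarrow> 'a pair_pre_digraph \<Rightarrow> ('a \<times> 'a \<Rightarrow> real) set" where
  "blp2_region B G = {y \<in> var_index G \<rightarrow>\<^sub>E B.
     bidirectional_constr G y \<and> non_bidirectional_constr G y \<and>
     in_sum_constr G y \<and> out_sum_constr G y \<and> through_sum_constr G y}"

definition P1 :: "'a pair_pre_digraph \<Rightarrow> ('a \<times> 'a \<Rightarrow> real) set" where
  "P1 G = blp1_region {0..1} G"

definition P2 :: "'a pair_pre_digraph \<Rightarrow> ('a \<times> 'a \<Rightarrow> real) set" where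
  "P2 G = blp2_region {0..1} G"

end

theory Submission
  imports Defs
begin

text \<open>
  Each of the constraints (2a)--(2c) for a pair \<open>(i, j)\<close> is the sum over \<open>u\<close> of triangle
  constraints on \<open>i\<close>, \<open>j\<close>, \<open>u\<close>.  For strictness, averaging hides a single violated triangle:
  on the arcless digraph with vertices \<open>0, 1, 2, 3\<close>, put value 3/4 on the cycle
  \<open>0 \<rightarrow> 1 \<rightarrow> 2 \<rightarrow> 0\<close>, 1/4 on its reverse and 1/2 elsewhere.  Writing \<open>y = 1/2 + d\<close>,
  the triangle constraints say that \<open>d\<close> sums to at most 1/2 around every 3-cycle, and
  (2a)--(2c) that this holds on average over the two 3-cycles through an arc.  The sum
  around \<open>0 \<rightarrow> 1 \<rightarrow> 2 \<rightarrow> 0\<close> is 3/4, but at most 1/4 around the cycles through 3.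
\<close>

lemma card_minus_two_mult_le_sum:
  fixes f :: "'a \<Rightarrow> real"
  assumes "finite A" "i \<in> A" "j \<in> A" "i \<noteq> j"
    and "\<And>u. u \<in> A - {i, j} \<Longrightarrow> c \<le> f u"
  shows "(real (card A) - 2) * c \<le> (\<Sum>u\<in>A - {i, j}. f u)"
proof -
  \<comment> \<open>Keeps the natural-number subtraction in \<open>card_Diff_subset\<close> from
    truncating.\<close>
  have "card {i, j} \<le> card A"
    using assms by (intro card_mono) auto
  then have "real (card A) - 2 = real (card (A - {i, j}))"
    using assms by (simp add: card_Diff_subset)
  then show ?thesis
    using sum_bounded_below[of "A - {i, j}" c f] assms(5) by simp
qed

lemma P1_subset_P2:
  assumes "finite (pverts G)"
  shows "P1 G \<subseteq> P2 G"
proof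
  fix y assume y: "y \<in> P1 G"
  then have tri: "y (i, k) + y (k, j) \<le> 1 + y (i, j)"
    if "i \<in> pverts G" "j \<in> pverts G" "k \<in> pverts G" "i \<noteq> j" "i \<noteq> k" "j \<noteq> k" for i j k
    using that unfolding P1_def blp1_region_def triangle_constr_def by force
  note sum_le = card_minus_two_mult_le_sum[OF assms]
  have "in_sum_constr G y"
    unfolding in_sum_constr_def
  proof (intro ballI impI)
    fix i j assume ij: "i \<in> pverts G" "j \<in> pverts G" "i \<noteq> j"
    show "(\<Sum>u\<in>pverts G - {i, j}. y (u, j) - y (u, i))
            \<ge> (real (card (pverts G)) - 2) * (y (i, j) - 1)"
    proof (rule sum_le[OF ij])
      fix u assume "u \<in> pverts G - {i, j}"
      \<comment> \<open>Triangle constraint for the path u -> i -> j; the other two sums use i -> j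
        -> u and i -> u -> j.\<close>
      then show "y (i, j) - 1 \<le> y (u, j) - y (u, i)"
        using tri[of u j i] ij by auto
    qed
  qed
  moreover have "out_sum_constr G y"
    unfolding out_sum_constr_def
  proof (intro ballI impI)
    fix i j assume ij: "i \<in> pverts G" "j \<in> pverts G" "i \<noteq> j"
    show "(\<Sum>u\<in>pverts G - {i, j}. y (i, u) - y (j, u))
            \<ge> (real (card (pverts G)) - 2) * (y (i, j) - 1)"
    proof (rule sum_le[OF ij])
      fix u assume "u \<in> pverts G - {i, j}"
      then show "y (i, j) - 1 \<le> y (i, u) - y (j, u)"
        using tri[of i u j] ij by auto
    qed
  qed
  moreover have "through_sum_constr G y"
    unfolding through_sum_constr_def
  proof (intro ballI impI)
    fix i j assume ij: "i \<in> pverts G" "j \<in> pverts G" "i \<noteq> j"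
    \<comment> \<open>Negated, since \<open>sum_le\<close> bounds sums from below.\<close>
    have "(real (card (pverts G)) - 2) * (- (y (i, j) + 1))
            \<le> (\<Sum>u\<in>pverts G - {i, j}. - (y (i, u) + y (u, j)))"
    proof (rule sum_le[OF ij])
      fix u assume "u \<in> pverts G - {i, j}"
      then show "- (y (i, j) + 1) \<le> - (y (i, u) + y (u, j))"
        using tri[of i j u] ij by auto
    qed
    then show "(\<Sum>u\<in>pverts G - {i, j}. y (i, u) + y (u, j))
                 \<le> (real (card (pverts G)) - 2) * (y (i, j) + 1)"
      unfolding sum_negf mult_minus_right by linarith
  qed
  ultimately show "y \<in> P2 G"
    using y unfolding P1_def P2_def blp1_region_def blp2_region_def by blast
qed

text \<open>Without arcs, opposite variables always sum to 1, so \<open>d\<close> is antisymmetric.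
  With only three vertices each sum would have a single term and be a triangle constraint
  itself.\<close>

definition arcless4 :: "nat pair_pre_digraph" where
  "arcless4 = \<lparr>pverts = {0, 1, 2, 3}, parcs = {}\<rparr>"

text \<open>An offset t on the cycle needs 3t > 1/2 to violate a triangle and 2t \<le> 1/2 for the
  averages; t = 1/4 is the largest choice.\<close>

definition cyclic_point :: "nat \<times> nat \<Rightarrow> real" where
  "cyclic_point = restrict
     (\<lambda>a. if a \<in> {(0, 1), (1, 2), (2, 0)} then 3/4
          else if a \<in> {(1, 0), (2, 1), (0, 2)} then 1/4 else 1/2)
     (var_index arcless4)"

lemma bp_fasp_arcless4: "bp_fasp arcless4 w"
  by unfold_locales (simp_all add: arcless4_def)

lemma cyclic_point_in_P2: "cyclic_point \<in> P2 arcless4"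
proof -
  have "cyclic_point \<in> var_index arcless4 \<rightarrow>\<^sub>E {0..1}"
    unfolding cyclic_point_def by (rule restrict_PiE_iff[THEN iffD2]) auto
  moreover have "bidirectional_constr arcless4 cyclic_point"
    by (simp add: bidirectional_constr_def arcless4_def)
  moreover have "non_bidirectional_constr arcless4 cyclic_point"
    by (simp add: non_bidirectional_constr_def cyclic_point_def var_index_def arcless4_def)
  moreover have "in_sum_constr arcless4 cyclic_point"
    by (simp add: in_sum_constr_def cyclic_point_def var_index_def arcless4_def insert_Diff_if)
  moreover have "out_sum_constr arcless4 cyclic_point"
    by (simp add: out_sum_constr_def cyclic_point_def var_index_def arcless4_def insert_Diff_if)
  moreover have "through_sum_constr arcless4 cyclic_point"
    by (simp add: through_sum_constr_def cyclic_point_def var_index_def arcless4_def insert_Diff_if)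
  ultimately show ?thesis
    by (simp add: P2_def blp2_region_def)
qed

lemma cyclic_point_notin_P1: "cyclic_point \<notin> P1 arcless4"
proof
  assume "cyclic_point \<in> P1 arcless4"
  then have "triangle_constr arcless4 cyclic_point"
    by (simp add: P1_def blp1_region_def)
  \<comment> \<open>The left-hand side is 1/4 - 3/4 - 3/4 = -5/4.\<close>
  then have "cyclic_point (0, 2) - cyclic_point (0, 1) - cyclic_point (1, 2) \<ge> - 1"
    by (simp add: triangle_constr_def arcless4_def)
  then show False
    by (simp add: cyclic_point_def var_index_def arcless4_def)
qed

theorem theorem2:
  shows "(\<forall>(G :: 'a pair_pre_digraph) w. bp_fasp G w \<longrightarrow> P1 G \<subseteq> P2 G) \<and>
         (\<exists>(H :: nat pair_pre_digraph) w. bp_fasp H w \<and> P1 H \<subset> P2 H)"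
proof (intro conjI allI impI exI)
  fix G :: "'a pair_pre_digraph" and w
  assume "bp_fasp G w"
  then interpret bp_fasp G w .
  show "P1 G \<subseteq> P2 G"
    by (rule P1_subset_P2) simp
next
  show "bp_fasp arcless4 (\<lambda>_. 0)"
    by (rule bp_fasp_arcless4)
next
  have "P1 arcless4 \<subseteq> P2 arcless4"
    by (rule P1_subset_P2) (simp add: arcless4_def)
  then show "P1 arcless4 \<subset> P2 arcless4"
    using cyclic_point_in_P2 cyclic_point_notin_P1 by blast
qed

end
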